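(* Let $y \in \mathbb{R}$ and $a\in\mathbb{C}$ with $\operatorname{Re} a>0$. Then $$\int_0^\infty \tanh\left(at\right)\left(\frac{1}{t} - \frac{t}{t^2 + y^2}\right) dt = -\psi\left(\frac{1}{2}\right) + \psi\left(\frac{1}{2} + \frac{a|y|}{\pi}\right),$$ and, if $y\neq0$, $$\int_0^\infty\frac{t}{t^2 + y^2}\left(1-\tanh\left(at\right)\right)dt = \psi\left(\frac{1}{2} + \frac{a|y|}{\pi}\right) + \ln\left(\frac{\pi}{a|y|}\right),$$ $$\int_0^\infty\left(\frac{\tanh\left(at\right)}{t} - \frac{t}{t^2 + y^2}\right)dt = \gamma + \ln\left(\frac{4a|y|}{\pi}\right).$$
   Context: $\psi=\Gamma'/\Gamma$ is the digamma function, $\gamma$ is Euler's constant, and $\ln$ is the principal logarithm. *)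

theory Defs
  imports "HOL-Complex_Analysis.Complex_Analysis"
begin

text \<open>The library introduces \<^term>\<open>Digamma\<close> by a series; it is the logarithmic
  derivative of the Gamma function.\<close>

lemma Digamma_eq_deriv_Gamma_over_Gamma:
  fixes z :: complex
  assumes "z \<notin> \<int>\<^sub>\<le>\<^sub>0"
  shows "Digamma z = deriv Gamma z / Gamma z"
proof -
  have "deriv Gamma z = Gamma z * Digamma z"
    using assms by (intro DERIV_imp_deriv has_field_derivative_Gamma)
  then show ?thesis
    using assms by (simp add: Gamma_eq_zero_iff)
qed

end

theory Submission
  imports Defs "HOL-Real_Asymp.Real_Asymp"
begin

text \<open>
  Throughout, let \<open>y > 0\<close> and \<open>z = a y / \<pi>\<close>; then \<open>Re z > 0\<close>.  For \<open>y = 0\<close> the first integrand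
  vanishes identically.

  The first integral comes from the partial fraction expansion
  \<open>tanh x = \<Sum>k. 2 x / (x\<^sup>2 + c\<^sub>k\<^sup>2)\<close> with \<open>c\<^sub>k = \<pi> (k + 1/2)\<close> (\<open>tanh_sums\<close>), itself the logarithmic
  derivative of the reflection formula for the Gamma function.  Multiplied by the kernel
  \<open>1/t - t/(t\<^sup>2 + y\<^sup>2) = y\<^sup>2 / (t (t\<^sup>2 + y\<^sup>2))\<close>, each term becomes a rational function of \<open>t\<close>, with
  integral \<open>1/(k + 1/2) - 1/(k + 1/2 + z)\<close>
  (\<open>has_integral_inverse_product_sum_squares\<close>), and these sum to \<open>\<psi>(1/2 + z) - \<psi>(1/2)\<close>.  The
  interchange of sum and integral is dominated because
  \<open>\<bar>a\<^sup>2 t\<^sup>2 + c\<^sup>2\<bar>\<close> stays comparable to \<open>\<bar>a\<bar>\<^sup>2 t\<^sup>2 + c\<^sup>2\<close> when \<open>Re a > 0\<close> (\<open>norm_add_square_ge\<close>).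

  For the second integral, write \<open>I(y)\<close> and \<open>J(y)\<close> for the first and the second integral.
  The integrand of \<open>I(y) - J(y)\<close> is \<open>tanh(a t)/t - t/(t\<^sup>2 + y\<^sup>2)\<close>, in which \<open>y\<close> is no longer coupled to
  \<open>tanh\<close>.  Hence \<open>(I(y) - J(y)) - (I(x) - J(x))\<close> is an elementary integral, equal to \<open>ln y - ln x\<close>,
  so \<open>I(y) - J(y) - ln y\<close> is a constant.  Letting \<open>y\<close> tend to infinity identifies it: \<open>J(y)\<close> tends to \<open>0\<close>
  because \<open>1 - tanh(a t)\<close> decays exponentially (\<open>ex_integral_one_minus_tanh\<close>), and \<open>\<psi>(1/2 + z) - ln z\<close>
  tends to \<open>0\<close> (\<open>Digamma_minus_Ln_tendsto_0\<close>).  Thus \<open>J(y) = \<psi>(1/2 + z) - ln z\<close>.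

  The third integral is the difference of the first two, with
  \<open>\<psi>(1/2) = - \<gamma> - 2 ln 2\<close>.
\<close>

section \<open>Integration over half-lines\<close>

lemma has_integral_Ioi_iff_Ici:
  fixes f :: "real \<Rightarrow> 'a :: banach"
  shows "(f has_integral I) {c<..} \<longleftrightarrow> (f has_integral I) {c..}"
proof (rule has_integral_spike_set_eq)
  show "negligible {x \<in> {c<..} - {c..}. f x \<noteq> 0}"
    by (rule negligible_subset[OF negligible_empty]) auto
  show "negligible {x \<in> {c..} - {c<..}. f x \<noteq> 0}"
    by (rule negligible_subset[OF negligible_sing[of c]]) auto
qed

text \<open>
  The integral over \<open>[c, c + n]\<close> is \<open>F (c + n) - F c\<close>; the dominating function \<open>h\<close> permits the
  passage to the limit \<open>n \<rightarrow> \<infinity>\<close> without any sign condition on \<open>f\<close>.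
\<close>

lemma fundamental_theorem_of_calculus_Ici:
  fixes f F :: "real \<Rightarrow> 'a :: euclidean_space"
  assumes deriv: "\<And>t. t \<ge> c \<Longrightarrow> (F has_vector_derivative f t) (at t within {c..})"
    and lim: "(F \<longlongrightarrow> L) at_top"
    and h: "h integrable_on {c..}"
    and dom: "\<And>t. t \<ge> c \<Longrightarrow> norm (f t) \<le> h t"
  shows "(f has_integral (L - F c)) {c..}"
proof (rule has_integral_dominated_convergence)
  show "((\<lambda>t. if t \<in> {c..c + real n} then f t else 0) has_integral (F (c + real n) - F c)) {c..}" for n
  proof -
    have "(f has_integral (F (c + real n) - F c)) {c..c + real n}"
      by (intro fundamental_theorem_of_calculus)
         (auto intro: has_vector_derivative_within_subset[OF deriv])
    thus ?thesis by (subst has_integral_restrict) auto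
  qed
  show "h integrable_on {c..}" by fact
  show "\<forall>t\<in>{c..}. norm (if t \<in> {c..c + real n} then f t else 0) \<le> h t" for n
  proof
    fix t assume "t \<in> {c..}"
    thus "norm (if t \<in> {c..c + real n} then f t else 0) \<le> h t"
      using dom[of t] norm_ge_zero[of "f t"] by (simp del: norm_ge_zero)
  qed
  show "\<forall>t\<in>{c..}. (\<lambda>n. if t \<in> {c..c + real n} then f t else 0) \<longlonglongrightarrow> f t"
  proof
    fix t assume t: "t \<in> {c..}"
    have "eventually (\<lambda>n. real n \<ge> t - c) sequentially"
      by real_asymp
    hence "eventually (\<lambda>n. (if t \<in> {c..c + real n} then f t else 0) = f t) sequentially"
      by eventually_elim (use t in auto)
    thus "(\<lambda>n. if t \<in> {c..c + real n} then f t else 0) \<longlonglongrightarrow> f t"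
      by (rule tendsto_eventually)
  qed
  have "filterlim (\<lambda>n. c + real n) at_top sequentially" by real_asymp
  from filterlim_compose[OF lim this] show "(\<lambda>n. F (c + real n) - F c) \<longlonglongrightarrow> L - F c"
    by (intro tendsto_intros)
qed

section \<open>Rational integrands\<close>

lemma has_integral_inverse_sum_squares:
  fixes y :: real
  assumes y: "y > 0"
  shows "((\<lambda>t. 1 / (t\<^sup>2 + y\<^sup>2)) has_integral (pi / (2 * y))) {0..}"
proof (rule has_integral_to_inf)
  have hi: "((\<lambda>t. 1 / (t\<^sup>2 + y\<^sup>2)) has_integral (arctan (x / y) / y - arctan (0 / y) / y)) {0..x}"
    if "x \<ge> 0" for x
    using that y
    by (intro fundamental_theorem_of_calculus)
       (auto intro!: derivative_eq_intros simp flip: has_real_derivative_iff_has_vector_derivative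
             simp: divide_simps power2_eq_square)
  show "(\<lambda>t. 1 / (t\<^sup>2 + y\<^sup>2)) integrable_on {0..x}" for x
    using hi by (cases "x \<ge> 0") auto
  have "((\<lambda>x. arctan (x / y) / y) \<longlongrightarrow> (pi / 2) / y) at_top"
    unfolding divide_inverse
    by (intro tendsto_mult tendsto_const filterlim_compose[OF tendsto_arctan_at_top[unfolded divide_inverse]])
       (use y in real_asymp)
  moreover have "\<forall>\<^sub>F x in at_top. integral {0..x} (\<lambda>t. 1 / (t\<^sup>2 + y\<^sup>2)) = arctan (x / y) / y"
    using eventually_ge_at_top[of 0] by eventually_elim (use hi integral_unique in fastforce)
  ultimately show "((\<lambda>x. integral {0..x} (\<lambda>t. 1 / (t\<^sup>2 + y\<^sup>2))) \<longlongrightarrow> pi / (2 * y)) at_top"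
    by (subst tendsto_cong) auto
qed auto

corollary integrable_inverse_sum_squares:
  fixes y :: real
  assumes "y > 0"
  shows "(\<lambda>t. C * (1 / (t\<^sup>2 + y\<^sup>2))) integrable_on {0..}"
  by (rule has_integral_integrable[OF has_integral_mult_right[OF has_integral_inverse_sum_squares[OF assms]]])

text \<open>
  This covers the case \<open>c = a y\<close> of \<open>has_integral_inverse_product_sum_squares\<close>, in which
  the two quadratic factors are proportional.
\<close>

lemma has_integral_inverse_sum_squares_square:
  fixes y :: real
  assumes y: "y > 0"
  shows "((\<lambda>t. 1 / (t\<^sup>2 + y\<^sup>2)\<^sup>2) has_integral (pi / (4 * y ^ 3))) {0..}"
proof -
  define F where "F = (\<lambda>t. t / (2 * y\<^sup>2 * (t\<^sup>2 + y\<^sup>2)) + arctan (t / y) / (2 * y ^ 3))"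
  have pos: "t\<^sup>2 + y\<^sup>2 > 0" for t using y by (simp add: add_nonneg_pos)
  have "((\<lambda>t. 1 / (t\<^sup>2 + y\<^sup>2)\<^sup>2) has_integral (pi / (4 * y ^ 3) - F 0)) {0..}"
  proof (rule fundamental_theorem_of_calculus_Ici)
    fix t :: real
    have arctan: "((\<lambda>t. arctan (t / y)) has_field_derivative y / (t\<^sup>2 + y\<^sup>2)) (at t within {0..})"
      using y pos[of t] by (auto intro!: derivative_eq_intros simp: field_simps power2_eq_square)
    have "((\<lambda>t. t / (2 * y\<^sup>2 * (t\<^sup>2 + y\<^sup>2))) has_field_derivative
            (y\<^sup>2 - t\<^sup>2) / (2 * y\<^sup>2 * (t\<^sup>2 + y\<^sup>2)\<^sup>2)) (at t within {0..})"
      using y pos[of t] by (auto intro!: derivative_eq_intros simp: divide_simps)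
        (simp add: power2_eq_square algebra_simps)
    from DERIV_add[OF this DERIV_cdivide[OF arctan, of "2 * y ^ 3"]]
    have "(F has_field_derivative (y\<^sup>2 - t\<^sup>2) / (2 * y\<^sup>2 * (t\<^sup>2 + y\<^sup>2)\<^sup>2) + y / (t\<^sup>2 + y\<^sup>2) / (2 * y ^ 3)) (at t within {0..})"
      unfolding F_def .
    also have "(y\<^sup>2 - t\<^sup>2) / (2 * y\<^sup>2 * (t\<^sup>2 + y\<^sup>2)\<^sup>2) + y / (t\<^sup>2 + y\<^sup>2) / (2 * y ^ 3) = 1 / (t\<^sup>2 + y\<^sup>2)\<^sup>2"
      using y pos[of t] by (simp add: divide_simps) (simp add: power2_eq_square power3_eq_cube algebra_simps)
    finally show "(F has_vector_derivative 1 / (t\<^sup>2 + y\<^sup>2)\<^sup>2) (at t within {0..})"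
      by (simp add: has_real_derivative_iff_has_vector_derivative)
    have "1 / ((t\<^sup>2 + y\<^sup>2) * (t\<^sup>2 + y\<^sup>2)) \<le> 1 / (y\<^sup>2 * (t\<^sup>2 + y\<^sup>2))"
      using y pos[of t] by (intro divide_left_mono mult_right_mono mult_pos_pos) auto
    thus "norm (1 / (t\<^sup>2 + y\<^sup>2)\<^sup>2) \<le> 1 / y\<^sup>2 * (1 / (t\<^sup>2 + y\<^sup>2))"
      by (simp add: power2_eq_square)
  next
    show "(F \<longlongrightarrow> pi / (4 * y ^ 3)) at_top"
      unfolding F_def using y by (real_asymp simp: field_simps)
    show "(\<lambda>t. 1 / y\<^sup>2 * (1 / (t\<^sup>2 + y\<^sup>2))) integrable_on {0..}"
      by (rule integrable_inverse_sum_squares[OF y])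
  qed
  thus ?thesis by (simp add: F_def)
qed

text \<open>
  With \<open>a = \<bar>a\<bar> e\<^sup>i\<^sup>\<theta>\<close>, rotating by \<open>e\<^sup>-\<^sup>i\<^sup>\<theta>\<close> puts both \<open>a\<^sup>2 t\<^sup>2\<close> and \<open>c\<^sup>2\<close> at angles \<open>\<plusminus>\<theta>\<close> from
  the positive real axis, so their real parts \<open>cos \<theta> \<bar>a\<bar>\<^sup>2 t\<^sup>2\<close> and \<open>cos \<theta> c\<^sup>2\<close> add up
  without cancellation; \<open>cos \<theta> = Re a / \<bar>a\<bar>\<close>.
\<close>

lemma norm_add_square_ge:
  fixes a :: complex
  assumes a: "Re a > 0"
  shows "norm (a\<^sup>2 * of_real (t\<^sup>2) + of_real (c\<^sup>2)) \<ge> Re a / norm a * (norm a ^ 2 * t\<^sup>2 + c\<^sup>2)"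
proof -
  have a0: "norm a > 0" using a by auto
  have "Re a * (norm a ^ 2 * t\<^sup>2 + c\<^sup>2) = Re (cnj a * (a\<^sup>2 * of_real (t\<^sup>2) + of_real (c\<^sup>2)))"
    by (simp add: cmod_power2) (simp add: power2_eq_square algebra_simps)
  also have "\<dots> \<le> norm (cnj a * (a\<^sup>2 * of_real (t\<^sup>2) + of_real (c\<^sup>2)))"
    by (rule complex_Re_le_cmod)
  also have "\<dots> = norm a * norm (a\<^sup>2 * of_real (t\<^sup>2) + of_real (c\<^sup>2))"
    by (simp add: norm_mult)
  finally show ?thesis using a0 by (simp add: divide_simps mult_ac)
qed

lemma Ln_times_ii_right:
  assumes "Re a > 0"
  shows "Ln (- \<i> * a) = Ln a - \<i> * of_real pi / 2" "Ln (\<i> * a) = Ln a + \<i> * of_real pi / 2"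
proof -
  show 1: "Ln (\<i> * a) = Ln a + \<i> * of_real pi / 2"
    using assms by (subst Ln_times_ii) auto
  have "Ln (- (\<i> * a)) = Ln (\<i> * a) - \<i> * of_real pi"
    using assms by (subst Ln_minus) auto
  thus "Ln (- \<i> * a) = Ln a - \<i> * of_real pi / 2" by (simp add: 1)
qed

text \<open>
  Complex scaling of \<open>t\<close> would move the path of integration, so an explicit antiderivative is used:
  the complex arctangent of \<open>a t / c\<close>, divided by \<open>c\<close>, but written with two separate logarithms.  The
  logarithm of the quotient \<open>(c - \<i> a t) / (c + \<i> a t)\<close> would approach its branch cut as
  \<open>t\<close> tends to infinity, whereas \<open>Ln (c \<plusminus> \<i> a t)\<close> differs from \<open>ln t + Ln (\<plusminus> \<i> a)\<close> by a null
  function.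
\<close>

lemma has_integral_complex_inverse_sum_squares:
  fixes a :: complex and c :: real
  assumes a: "Re a > 0" and c: "c > 0"
  shows "((\<lambda>t. a / (a\<^sup>2 * of_real (t\<^sup>2) + of_real (c\<^sup>2))) has_integral of_real (pi / (2 * c))) {0..}"
proof -
  define F where "F = (\<lambda>t::real. \<i> / (2 * of_real c) * (Ln (of_real c - \<i> * a * of_real t) - Ln (of_real c + \<i> * a * of_real t)))"
  have nz: "of_real c - \<i> * a * of_real t \<notin> \<real>\<^sub>\<le>\<^sub>0" "of_real c + \<i> * a * of_real t \<notin> \<real>\<^sub>\<le>\<^sub>0"
    if "t \<ge> 0" for t
    using that a c by (auto simp: complex_nonpos_Reals_iff)
  have der: "(F has_vector_derivative a / (a\<^sup>2 * of_real (t\<^sup>2) + of_real (c\<^sup>2))) (at t within {0..})"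
    if t: "t \<ge> 0" for t
  proof -
    have n0: "of_real c - \<i> * a * of_real t \<noteq> 0" "of_real c + \<i> * a * of_real t \<noteq> 0"
      using nz[OF t] by auto
    have prod: "(of_real c - \<i> * a * of_real t) * (of_real c + \<i> * a * of_real t) =
         a\<^sup>2 * of_real (t\<^sup>2) + of_real (c\<^sup>2)"
      by (simp add: algebra_simps power2_eq_square)
    have Ln: "((\<lambda>t. Ln (of_real c + b * t)) has_field_derivative b / (of_real c + b * z)) (at z)"
      if "of_real c + b * z \<notin> \<real>\<^sub>\<le>\<^sub>0" for b z :: complex
    proof -
      have "((\<lambda>t. of_real c + b * t) has_field_derivative b) (at z)"
        by (auto intro!: derivative_eq_intros)
      from DERIV_chain2[where f = Ln, OF has_field_derivative_Ln[OF that] this]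
      show ?thesis by (simp add: divide_inverse mult.commute)
    qed
    have "((\<lambda>t. \<i> / (2 * of_real c) * (Ln (of_real c - \<i> * a * t) - Ln (of_real c + \<i> * a * t)))
       has_field_derivative \<i> / (2 * of_real c) * (- \<i> * a / (of_real c - \<i> * a * of_real t) -
            \<i> * a / (of_real c + \<i> * a * of_real t))) (at (of_real t))"
      using nz[OF t] Ln[of "- \<i> * a" "of_real t"] Ln[of "\<i> * a" "of_real t"]
      by (intro DERIV_cmult DERIV_diff) simp_all
    also have "\<i> / (2 * of_real c) * (- \<i> * a / (of_real c - \<i> * a * of_real t) -
            \<i> * a / (of_real c + \<i> * a * of_real t)) =
            a / ((of_real c - \<i> * a * of_real t) * (of_real c + \<i> * a * of_real t))"
      using n0 c by (simp add: divide_simps) (simp add: algebra_simps)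
    also note prod
    finally show ?thesis unfolding F_def
      by (rule has_vector_derivative_real_field)
  qed
  have lim: "(F \<longlongrightarrow> of_real (pi / (2 * c))) at_top"
  proof (rule Lim_transform_eventually)
    have a': "- \<i> * a \<notin> \<real>\<^sub>\<le>\<^sub>0" "\<i> * a \<notin> \<real>\<^sub>\<le>\<^sub>0"
      using a by (auto simp: complex_nonpos_Reals_iff)
    have ct: "((\<lambda>t. of_real (c / t)) \<longlongrightarrow> complex_of_real 0) at_top"
      by (intro tendsto_of_real) real_asymp
    have "((\<lambda>t::real. \<i> / (2 * of_real c) * (Ln (of_real (c / t) + (- \<i> * a)) - Ln (of_real (c / t) + \<i> * a)))
        \<longlongrightarrow> \<i> / (2 * of_real c) * (Ln (of_real 0 + (- \<i> * a)) - Ln (of_real 0 + \<i> * a))) at_top"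
      by (intro tendsto_intros ct) (use a' in auto)
    also have "\<i> / (2 * of_real c) * (Ln (of_real 0 + (- \<i> * a)) - Ln (of_real 0 + \<i> * a)) = of_real (pi / (2 * c))"
      using Ln_times_ii_right[OF a] by simp
    finally show "((\<lambda>t::real. \<i> / (2 * of_real c) * (Ln (of_real (c / t) + (- \<i> * a)) - Ln (of_real (c / t) + \<i> * a)))
        \<longlongrightarrow> of_real (pi / (2 * c))) at_top" .
    show "\<forall>\<^sub>F t in at_top. \<i> / (2 * of_real c) * (Ln (of_real (c / t) + (- \<i> * a)) - Ln (of_real (c / t) + \<i> * a)) = F t"
      using eventually_gt_at_top[of 0]
    proof eventually_elim
      case (elim t)
      have e: "of_real c - \<i> * a * of_real t = of_real t * (of_real (c / t) + (- \<i> * a))"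
           "of_real c + \<i> * a * of_real t = of_real t * (of_real (c / t) + \<i> * a)"
        using elim by (auto simp: algebra_simps)
      have "of_real (c / t) + (- \<i> * a) \<noteq> 0" "of_real (c / t) + \<i> * a \<noteq> 0"
        using elim nz[of t] e by auto
      hence "Ln (of_real t * (of_real (c / t) + (- \<i> * a))) = of_real (ln t) + Ln (of_real (c / t) + (- \<i> * a))"
            "Ln (of_real t * (of_real (c / t) + \<i> * a)) = of_real (ln t) + Ln (of_real (c / t) + \<i> * a)"
        using Ln_times_of_real[OF elim, of "of_real (c / t) + (- \<i> * a)"]
          Ln_times_of_real[OF elim, of "of_real (c / t) + \<i> * a"] elim by (simp_all add: Ln_of_real del: minus_mult_left)
      thus ?case unfolding F_def e by simp
    qed
  qed
  have "((\<lambda>t. a / (a\<^sup>2 * of_real (t\<^sup>2) + of_real (c\<^sup>2))) has_integral (of_real (pi / (2 * c)) - F 0)) {0..}"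
  proof (rule fundamental_theorem_of_calculus_Ici[OF der lim])
    (* The majorant from norm_add_square_ge, reduced by (norm a)^2 to a multiple of a real kernel. *)
    define h where "h = (\<lambda>t. 1 / Re a * (1 / (t\<^sup>2 + (c / norm a)\<^sup>2)))"
    have na: "norm a > 0" using a by auto
    show "h integrable_on {0..}" unfolding h_def
      by (rule integrable_inverse_sum_squares) (use na c in auto)
    fix t :: real assume "t \<ge> 0"
    show "norm (a / (a\<^sup>2 * of_real (t\<^sup>2) + of_real (c\<^sup>2))) \<le> h t"
    proof -
      let ?s = "norm a ^ 2 * t\<^sup>2 + c\<^sup>2"
      have s: "?s > 0" using c by (intro add_nonneg_pos) auto
      have pos: "Re a / norm a * ?s > 0" using a na s by simp
      have "norm (a / (a\<^sup>2 * of_real (t\<^sup>2) + of_real (c\<^sup>2))) \<le> norm a / (Re a / norm a * ?s)"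
        unfolding norm_divide
        by (rule divide_left_mono[OF norm_add_square_ge[OF a] norm_ge_zero])
           (intro mult_pos_pos pos less_le_trans[OF pos norm_add_square_ge[OF a]])
      also have "\<dots> = h t"
        using na a s by (simp add: h_def divide_simps) (simp add: power2_eq_square algebra_simps)
      finally show ?thesis .
    qed
  qed
  thus ?thesis by (simp add: F_def)
qed

text \<open>
  Partial fractions: the two factors satisfy \<open>(a\<^sup>2 t\<^sup>2 + c\<^sup>2) - a\<^sup>2 (t\<^sup>2 + y\<^sup>2) = (c - a y) (c + a y)\<close>.
  The factor \<open>c - a y\<close> cancels from the value, so the formula persists when it vanishes,
  although that case needs its own antiderivative.
\<close>

lemma has_integral_inverse_product_sum_squares:
  fixes a :: complex and c y :: real
  assumes a: "Re a > 0" and c: "c > 0" and y: "y > 0"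
  shows "((\<lambda>t. 1 / ((a\<^sup>2 * of_real (t\<^sup>2) + of_real (c\<^sup>2)) * of_real (t\<^sup>2 + y\<^sup>2))) has_integral
           (of_real pi / (2 * of_real (c * y) * (of_real c + a * of_real y)))) {0..}"
proof -
  have pos: "t\<^sup>2 + y\<^sup>2 > 0" for t using y by (simp add: add_nonneg_pos)
  have ca: "of_real c + a * of_real y \<noteq> 0"
  proof -
    have "Re (of_real c + a * of_real y) > 0"
      using a c y by (simp add: add_pos_pos)
    thus ?thesis by (metis zero_complex.sel(1) less_irrefl)
  qed
  show ?thesis
  proof (cases "of_real c = a * of_real y")
    case True
    have a0: "a \<noteq> 0" using a by auto
    have *: "((\<lambda>t. 1 / a\<^sup>2 * of_real (1 / (t\<^sup>2 + y\<^sup>2)\<^sup>2)) has_integral (1 / a\<^sup>2 * of_real (pi / (4 * y ^ 3)))) {0..}"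
      by (intro has_integral_mult_right has_integral_of_real has_integral_inverse_sum_squares_square y)
    have "1 / a\<^sup>2 * of_real (pi / (4 * y ^ 3)) = of_real pi / (2 * of_real (c * y) * (of_real c + a * of_real y))"
      using y a0 by (simp add: True power2_eq_square power3_eq_cube)
    moreover have "1 / a\<^sup>2 * of_real (1 / (t\<^sup>2 + y\<^sup>2)\<^sup>2) =
       1 / ((a\<^sup>2 * of_real (t\<^sup>2) + of_real (c\<^sup>2)) * of_real (t\<^sup>2 + y\<^sup>2))" for t
    proof -
      have "a\<^sup>2 * of_real (t\<^sup>2) + of_real (c\<^sup>2) = a\<^sup>2 * of_real (t\<^sup>2 + y\<^sup>2)"
        by (simp add: True power_mult_distrib algebra_simps)
      thus ?thesis by (simp add: power2_eq_square)
    qed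
    ultimately show ?thesis using * by presburger
  next
    case False
    define d where "d = (of_real c - a * of_real y) * (of_real c + a * of_real y)"
    have d: "d \<noteq> 0" using False ca by (auto simp: d_def)
    have "((\<lambda>t. (of_real (1 / (t\<^sup>2 + y\<^sup>2)) - a * (a / (a\<^sup>2 * of_real (t\<^sup>2) + of_real (c\<^sup>2)))) / d)
       has_integral ((of_real (pi / (2 * y)) - a * of_real (pi / (2 * c))) / d)) {0..}"
      by (intro has_integral_divide has_integral_diff has_integral_mult_right has_integral_of_real
            has_integral_inverse_sum_squares y has_integral_complex_inverse_sum_squares a c)
    also have "(of_real (pi / (2 * y)) - a * of_real (pi / (2 * c))) / d =
       of_real pi / (2 * of_real (c * y) * (of_real c + a * of_real y))"
    proof -
      have "of_real (pi / (2 * y)) - a * of_real (pi / (2 * c)) = of_real pi * (of_real c - a * of_real y) / (2 * of_real (c * y))"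
        using c y by (simp add: field_simps)
      thus ?thesis using False ca by (simp add: d_def)
    qed
    also have "(\<lambda>t. (of_real (1 / (t\<^sup>2 + y\<^sup>2)) - a * (a / (a\<^sup>2 * of_real (t\<^sup>2) + of_real (c\<^sup>2)))) / d) =
         (\<lambda>t. 1 / ((a\<^sup>2 * of_real (t\<^sup>2) + of_real (c\<^sup>2)) * of_real (t\<^sup>2 + y\<^sup>2)))"
    proof
      fix t :: real
      define u v where "u = a\<^sup>2 * of_real (t\<^sup>2) + of_real (c\<^sup>2)" and "v = complex_of_real (t\<^sup>2 + y\<^sup>2)"
      have "Re a / norm a * (norm a ^ 2 * t\<^sup>2 + c\<^sup>2) > 0"
        using a c by (intro mult_pos_pos divide_pos_pos add_nonneg_pos) auto
      hence "norm u > 0" using norm_add_square_ge[OF a, of t c] unfolding u_def by linarith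
      hence u: "u \<noteq> 0" by auto
      have v: "v \<noteq> 0" using pos[of t] unfolding v_def by (simp only: of_real_eq_0_iff)
      have "u - a\<^sup>2 * v = d"
        by (simp add: u_def v_def d_def power2_eq_square algebra_simps)
      moreover have "(1 / v - a * (a / u)) = (u - a\<^sup>2 * v) / (u * v)"
        using u v by (simp add: field_simps power2_eq_square)
      ultimately have "(1 / v - a * (a / u)) / d = 1 / (u * v)"
        using d by simp
      thus "(of_real (1 / (t\<^sup>2 + y\<^sup>2)) - a * (a / (a\<^sup>2 * of_real (t\<^sup>2) + of_real (c\<^sup>2)))) / d =
         1 / ((a\<^sup>2 * of_real (t\<^sup>2) + of_real (c\<^sup>2)) * of_real (t\<^sup>2 + y\<^sup>2))"
        unfolding u_def v_def of_real_divide of_real_1 .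
    qed
    finally show ?thesis .
  qed
qed

text \<open>
  The logarithmic divergences of the two terms at infinity cancel.
\<close>

lemma has_integral_kernel_difference:
  fixes x y :: real
  assumes x: "x > 0" and y: "y > 0"
  shows "((\<lambda>t. t / (t\<^sup>2 + x\<^sup>2) - t / (t\<^sup>2 + y\<^sup>2)) has_integral (ln y - ln x)) {0..}"
proof -
  define F where "F = (\<lambda>t. (ln (t\<^sup>2 + x\<^sup>2) - ln (t\<^sup>2 + y\<^sup>2)) / 2)"
  have pos: "t\<^sup>2 + x\<^sup>2 > 0" "t\<^sup>2 + y\<^sup>2 > 0" for t using x y by (simp_all add: add_nonneg_pos)
  have "((\<lambda>t. t / (t\<^sup>2 + x\<^sup>2) - t / (t\<^sup>2 + y\<^sup>2)) has_integral (0 - F 0)) {0..}"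
  proof (rule fundamental_theorem_of_calculus_Ici)
    fix t :: real assume t: "t \<ge> 0"
    have "(F has_field_derivative (t / (t\<^sup>2 + x\<^sup>2) - t / (t\<^sup>2 + y\<^sup>2))) (at t within {0..})"
      unfolding F_def using pos[of t] by (auto intro!: derivative_eq_intros simp: divide_simps)
    thus "(F has_vector_derivative (t / (t\<^sup>2 + x\<^sup>2) - t / (t\<^sup>2 + y\<^sup>2))) (at t within {0..})"
      by (simp add: has_real_derivative_iff_has_vector_derivative)
    have "t / (t\<^sup>2 + x\<^sup>2) \<le> 1 / (2 * x)"
      using sum_squares_bound[of t x] pos[of t] x by (simp add: divide_simps mult_ac)
    hence "\<bar>y\<^sup>2 - x\<^sup>2\<bar> * (t / (t\<^sup>2 + x\<^sup>2)) * (1 / (t\<^sup>2 + y\<^sup>2)) \<le> \<bar>y\<^sup>2 - x\<^sup>2\<bar> * (1 / (2 * x)) * (1 / (t\<^sup>2 + y\<^sup>2))"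
      using pos[of t] by (intro mult_right_mono mult_left_mono) auto
    moreover have "t / (t\<^sup>2 + x\<^sup>2) - t / (t\<^sup>2 + y\<^sup>2) = (y\<^sup>2 - x\<^sup>2) * (t / (t\<^sup>2 + x\<^sup>2)) * (1 / (t\<^sup>2 + y\<^sup>2))"
      using pos[of t] by (simp add: divide_simps) (simp add: algebra_simps)
    ultimately show "norm (t / (t\<^sup>2 + x\<^sup>2) - t / (t\<^sup>2 + y\<^sup>2)) \<le> \<bar>y\<^sup>2 - x\<^sup>2\<bar> * (1 / (2 * x)) * (1 / (t\<^sup>2 + y\<^sup>2))"
      using t pos[of t] by (simp add: abs_mult)
  next
    show "(F \<longlongrightarrow> 0) at_top" unfolding F_def using x y by real_asymp
    show "(\<lambda>t. \<bar>y\<^sup>2 - x\<^sup>2\<bar> * (1 / (2 * x)) * (1 / (t\<^sup>2 + y\<^sup>2))) integrable_on {0..}"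
      by (rule integrable_inverse_sum_squares[OF y])
  qed
  also have "0 - F 0 = ln y - ln x" using x y by (simp add: F_def ln_realpow diff_divide_distrib)
  finally show ?thesis .
qed

section \<open>Partial fractions of the hyperbolic tangent\<close>

lemma Digamma_diff_sums:
  fixes u v :: complex
  assumes "u \<noteq> 0" "v \<noteq> 0"
  shows "(\<lambda>n. 1 / (v + of_nat n) - 1 / (u + of_nat n)) sums (Digamma u - Digamma v)"
proof -
  have "(\<lambda>m. \<Sum>n<m. 1 / (v + of_nat n) - 1 / (u + of_nat n)) =
        (\<lambda>m. (of_real (ln (real m)) - (\<Sum>n<m. inverse (u + of_nat n))) -
             (of_real (ln (real m)) - (\<Sum>n<m. inverse (v + of_nat n))))"
    by (simp add: fun_eq_iff sum_subtractf inverse_eq_divide)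
  also have "\<dots> \<longlonglongrightarrow> Digamma u - Digamma v"
    by (intro tendsto_diff Digamma_LIMSEQ assms)
  finally show ?thesis by (simp add: sums_def)
qed

text \<open>
  Logarithmic derivative of \<open>\<Gamma>(1/2 + w) \<Gamma>(1/2 - w) = \<pi> / cos (\<pi> w)\<close>.
\<close>

lemma Digamma_reflection_half:
  fixes w :: complex
  assumes "1/2 + w \<notin> \<int>\<^sub>\<le>\<^sub>0" "1/2 - w \<notin> \<int>\<^sub>\<le>\<^sub>0"
  shows "Digamma (1/2 + w) - Digamma (1/2 - w) = of_real pi * tan (of_real pi * w)"
proof -
  let ?G = "\<lambda>w::complex. Gamma (1/2 + w) * Gamma (1/2 - w)"
  have eq: "?G w = of_real pi / cos (of_real pi * w)" for w
    using Gamma_reflection_complex[of "1/2 + w"]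
    by (simp add: algebra_simps sin_add)
  have G0: "?G w \<noteq> 0" using assms by (simp add: Gamma_eq_zero_iff)
  hence c0: "cos (of_real pi * w) \<noteq> 0" unfolding eq by auto
  have "(?G has_field_derivative ?G w * (Digamma (1/2 + w) - Digamma (1/2 - w))) (at w)"
    using assms by (auto intro!: derivative_eq_intros simp: algebra_simps)
  moreover have "((\<lambda>w. of_real pi / cos (of_real pi * w)) has_field_derivative
      ?G w * (of_real pi * tan (of_real pi * w))) (at w)"
    unfolding eq using c0 by (auto intro!: derivative_eq_intros simp: tan_def field_simps power2_eq_square)
  ultimately have "?G w * (Digamma (1/2 + w) - Digamma (1/2 - w)) = ?G w * (of_real pi * tan (of_real pi * w))"
    unfolding eq using DERIV_unique by blast
  thus ?thesis using G0 by simp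
qed

text \<open>
  With \<open>w = \<i> x / \<pi>\<close>, \<open>tanh x\<close> is \<open>- \<i> tan (\<pi> w)\<close>, and subtracting the series for \<open>\<psi>(1/2 + w)\<close> and
  \<open>\<psi>(1/2 - w)\<close> termwise pairs up the poles at \<open>\<plusminus> (k + 1/2)\<close>.
\<close>

lemma tanh_sums:
  fixes x :: complex
  assumes "Re x > 0"
  shows "(\<lambda>n. 2 * x / (x\<^sup>2 + of_real ((pi * (real n + 1/2))\<^sup>2))) sums tanh x"
proof -
  define w where "w = \<i> * x / of_real pi"
  have imw: "Im w > 0" using assms by (simp add: w_def)
  have nz: "of_real r + w \<noteq> 0" "of_real r - w \<noteq> 0" for r
    using imw by (auto simp: complex_eq_iff)
  have nonint: "1/2 + w \<notin> \<int>\<^sub>\<le>\<^sub>0" "1/2 - w \<notin> \<int>\<^sub>\<le>\<^sub>0"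
    using imw by (auto elim!: nonpos_Ints_cases simp: complex_eq_iff)
  have "(\<lambda>n. 1 / ((1/2 - w) + of_nat n) - 1 / ((1/2 + w) + of_nat n)) sums
           (of_real pi * tan (of_real pi * w))"
    using Digamma_diff_sums[of "1/2 + w" "1/2 - w"] nz[of "1/2"] Digamma_reflection_half[OF nonint]
    by simp
  hence "(\<lambda>n. - \<i> / of_real pi * (1 / ((1/2 - w) + of_nat n) - 1 / ((1/2 + w) + of_nat n))) sums
           (- \<i> / of_real pi * (of_real pi * tan (of_real pi * w)))"
    by (rule sums_mult)
  also have "- \<i> / of_real pi * (of_real pi * tan (of_real pi * w)) = tanh x"
    by (simp add: w_def tanh_conv_tan)
  also have "(\<lambda>n. - \<i> / of_real pi * (1 / ((1/2 - w) + of_nat n) - 1 / ((1/2 + w) + of_nat n))) =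
        (\<lambda>n. 2 * x / (x\<^sup>2 + of_real ((pi * (real n + 1/2))\<^sup>2)))"
  proof
    fix n
    define c :: complex where "c = of_nat n + 1/2"
    have c0: "c + w \<noteq> 0" "c - w \<noteq> 0" using nz[of "of_nat n + 1/2"] by (auto simp: c_def)
    have x: "x = - \<i> * of_real pi * w" by (simp add: w_def)
    have c: "of_real ((pi * (real n + 1/2))\<^sup>2) = (of_real pi * c)\<^sup>2" by (simp add: c_def)
    have "x\<^sup>2 + (of_real pi * c)\<^sup>2 = (of_real pi)\<^sup>2 * ((c - w) * (c + w))"
      by (simp add: x algebra_simps power2_eq_square)
    hence "2 * x / (x\<^sup>2 + of_real ((pi * (real n + 1/2))\<^sup>2)) = 2 * x / ((of_real pi)\<^sup>2 * ((c - w) * (c + w)))"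
      unfolding c by simp
    also have "\<dots> = - \<i> / of_real pi * (1 / (c - w) - 1 / (c + w))"
      using c0 by (simp add: x divide_simps power2_eq_square)
    finally show "- \<i> / of_real pi * (1 / ((1/2 - w) + of_nat n) - 1 / ((1/2 + w) + of_nat n)) =
        2 * x / (x\<^sup>2 + of_real ((pi * (real n + 1/2))\<^sup>2))"
      by (simp add: c_def algebra_simps)
  qed
  finally show ?thesis .
qed

text \<open>
  Termwise integration of the partial fractions of \<open>tanh\<close>.  The majorant of the partial sums
  is a constant multiple of \<open>1 / (t\<^sup>2 + y\<^sup>2)\<close>, the constant containing \<open>\<Sum>k. 1 / c\<^sub>k\<^sup>2\<close>.
\<close>

lemma has_integral_tanh_kernel:
  fixes a :: complex and y :: real
  assumes a: "Re a > 0" and y: "y > 0"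
  shows "((\<lambda>t. tanh (a * of_real t) * of_real (1 / t - t / (t\<^sup>2 + y\<^sup>2))) has_integral
            (Digamma (1/2 + a * of_real y / of_real pi) - Digamma (1/2))) {0<..}"
proof (rule has_integral_dominated_convergence)
  define c where "c = (\<lambda>k. pi * (real k + 1/2))"
  have c: "c k > 0" for k by (simp add: c_def add_nonneg_pos)
  define f where "f = (\<lambda>k t. 2 * a * of_real y ^ 2 * (1 / ((a\<^sup>2 * of_real (t\<^sup>2) + of_real ((c k)\<^sup>2)) * of_real (t\<^sup>2 + y\<^sup>2))))"
  define z where "z = a * of_real y / of_real pi"
  define A where "A = (\<lambda>k. 1 / (1/2 + of_nat k) - 1 / (1/2 + z + of_nat k))"
  have pos: "t\<^sup>2 + y\<^sup>2 > 0" for t using y by (simp add: add_nonneg_pos)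
  have rez: "Re z > 0" using a y by (simp add: z_def)
  have na: "norm a > 0" using a by auto
  have fint: "(f k has_integral A k) {0<..}" for k
  proof -
    have "(f k has_integral 2 * a * of_real y ^ 2 * (of_real pi / (2 * of_real (c k * y) * (of_real (c k) + a * of_real y)))) {0<..}"
      unfolding f_def has_integral_Ioi_iff_Ici
      by (intro has_integral_mult_right has_integral_inverse_product_sum_squares a c y)
    also have "2 * a * of_real y ^ 2 * (of_real pi / (2 * of_real (c k * y) * (of_real (c k) + a * of_real y))) = A k"
    proof -
      define q :: complex where "q = 1/2 + of_nat k"
      have ck: "of_real (c k) = of_real pi * q" by (simp add: c_def q_def algebra_simps)
      have q0: "q \<noteq> 0" using c[of k] ck by auto
      have qz0: "q + z \<noteq> 0" using rez by (auto simp: complex_eq_iff q_def)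
      have ay: "a * of_real y = of_real pi * z" by (simp add: z_def)
      have "2 * a * of_real y ^ 2 * (of_real pi / (2 * of_real (c k * y) * (of_real (c k) + a * of_real y))) =
         (a * of_real y) * of_real pi / (of_real (c k) * (of_real (c k) + a * of_real y))"
        using y c[of k] by (simp add: power2_eq_square)
      also have "\<dots> = z / (q * (q + z))"
        unfolding ay ck by (simp flip: distrib_left)
      also have "\<dots> = 1 / q - 1 / (q + z)"
        using q0 qz0 by (simp add: field_simps)
      finally show ?thesis by (simp add: A_def q_def algebra_simps)
    qed
    finally show ?thesis .
  qed
  show "((\<lambda>t. \<Sum>k<n. f k t) has_integral (\<Sum>k<n. A k)) {0<..}" for n
    by (intro has_integral_sum fint) auto
  show "(\<lambda>n. \<Sum>k<n. A k) \<longlonglongrightarrow> Digamma (1/2 + a * of_real y / of_real pi) - Digamma (1/2)"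
  proof -
    have "1/2 + z \<noteq> 0" using rez by (auto simp: complex_eq_iff)
    hence "A sums (Digamma (1/2 + z) - Digamma (1/2))"
      unfolding A_def by (intro Digamma_diff_sums) auto
    thus ?thesis by (simp add: sums_def z_def)
  qed
  define B where "B = (\<lambda>k. 1 / (c k)\<^sup>2)"
  have "summable (\<lambda>n. 1 / (real (Suc n))\<^sup>2)"
    using inverse_power_summable[of 2, where ?'a = real] by (subst summable_Suc_iff) (simp add: inverse_eq_divide)
  hence Bsum: "summable B"
  proof (rule summable_comparison_test'[where N = 0])
    fix k :: nat
    have "real (Suc k) \<le> c k" using pi_ge_two mult_mono[of 2 pi "real k + 1/2" "real k + 1/2"]
      by (simp add: c_def)
    hence "1 / (c k)\<^sup>2 \<le> 1 / (real (Suc k))\<^sup>2"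
      by (intro divide_left_mono power_mono mult_pos_pos) (use c[of k] in auto)
    thus "norm (B k) \<le> 1 / (real (Suc k))\<^sup>2" by (simp add: B_def)
  qed
  define h where "h = (\<lambda>t. 2 * norm a ^ 2 * y\<^sup>2 / Re a * suminf B * (1 / (t\<^sup>2 + y\<^sup>2)))"
  show "h integrable_on {0<..}"
    using integrable_inverse_sum_squares[OF y] unfolding h_def integrable_on_def has_integral_Ioi_iff_Ici .
  have fbound: "norm (f k t) \<le> 2 * norm a ^ 2 * y\<^sup>2 / Re a * (1 / (t\<^sup>2 + y\<^sup>2)) * B k" for k t
  proof -
    let ?N = "norm (a\<^sup>2 * of_real (t\<^sup>2) + of_real ((c k)\<^sup>2))"
    have "Re a / norm a * (c k)\<^sup>2 \<le> Re a / norm a * (norm a ^ 2 * t\<^sup>2 + (c k)\<^sup>2)"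
      using a by (intro mult_left_mono) auto
    also have "\<dots> \<le> ?N" by (rule norm_add_square_ge[OF a])
    finally have N: "?N \<ge> Re a / norm a * (c k)\<^sup>2" .
    have N0: "Re a / norm a * (c k)\<^sup>2 > 0" using a na c[of k] by simp
    have "norm (f k t) = 2 * norm a * y\<^sup>2 * (1 / (?N * (t\<^sup>2 + y\<^sup>2)))"
      using pos[of t] by (simp only: f_def norm_mult norm_divide norm_of_real norm_power norm_one norm_numeral) simp
    also have "\<dots> \<le> 2 * norm a * y\<^sup>2 * (1 / (Re a / norm a * (c k)\<^sup>2 * (t\<^sup>2 + y\<^sup>2)))"
    proof (intro mult_left_mono divide_left_mono)
      show "Re a / norm a * (c k)\<^sup>2 * (t\<^sup>2 + y\<^sup>2) \<le> ?N * (t\<^sup>2 + y\<^sup>2)"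
        using N pos[of t] by (intro mult_right_mono) auto
      show "0 < ?N * (t\<^sup>2 + y\<^sup>2) * (Re a / norm a * (c k)\<^sup>2 * (t\<^sup>2 + y\<^sup>2))"
        by (intro mult_pos_pos[OF mult_pos_pos mult_pos_pos] pos N0 less_le_trans[OF N0 N])
    qed auto
    also have "\<dots> = 2 * norm a ^ 2 * y\<^sup>2 / Re a * (1 / (t\<^sup>2 + y\<^sup>2)) * B k"
      by (simp add: B_def power2_eq_square mult_ac)
    finally show ?thesis .
  qed
  show "\<forall>t\<in>{0<..}. norm (\<Sum>k<n. f k t) \<le> h t" for n
  proof
    fix t :: real
    have "norm (\<Sum>k<n. f k t) \<le> (\<Sum>k<n. 2 * norm a ^ 2 * y\<^sup>2 / Re a * (1 / (t\<^sup>2 + y\<^sup>2)) * B k)"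
      by (intro sum_norm_le fbound)
    also have "\<dots> = 2 * norm a ^ 2 * y\<^sup>2 / Re a * (1 / (t\<^sup>2 + y\<^sup>2)) * (\<Sum>k<n. B k)"
      by (simp add: sum_distrib_left)
    also have "\<dots> \<le> 2 * norm a ^ 2 * y\<^sup>2 / Re a * (1 / (t\<^sup>2 + y\<^sup>2)) * suminf B"
      using a pos[of t] by (intro mult_left_mono sum_le_suminf Bsum) (auto simp: B_def)
    finally show "norm (\<Sum>k<n. f k t) \<le> h t" by (simp add: h_def mult_ac)
  qed
  show "\<forall>t\<in>{0<..}. (\<lambda>n. \<Sum>k<n. f k t) \<longlonglongrightarrow> tanh (a * of_real t) * of_real (1 / t - t / (t\<^sup>2 + y\<^sup>2))"
  proof
    fix t :: real assume t: "t \<in> {0<..}"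
    have kern: "1 / t - t / (t\<^sup>2 + y\<^sup>2) = y\<^sup>2 / (t * (t\<^sup>2 + y\<^sup>2))"
      using t pos[of t] by (simp add: field_simps power2_eq_square)
    have "(\<lambda>n. 2 * (a * of_real t) / ((a * of_real t)\<^sup>2 + of_real ((c n)\<^sup>2)) * of_real (1 / t - t / (t\<^sup>2 + y\<^sup>2)))
            sums (tanh (a * of_real t) * of_real (1 / t - t / (t\<^sup>2 + y\<^sup>2)))"
      unfolding c_def using a t by (intro sums_mult2 tanh_sums) auto
    also have "(\<lambda>n. 2 * (a * of_real t) / ((a * of_real t)\<^sup>2 + of_real ((c n)\<^sup>2)) * of_real (1 / t - t / (t\<^sup>2 + y\<^sup>2))) = (\<lambda>k. f k t)"
      using t unfolding kern f_def by (simp add: fun_eq_iff power_mult_distrib)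
    finally show "(\<lambda>n. \<Sum>k<n. f k t) \<longlonglongrightarrow> tanh (a * of_real t) * of_real (1 / t - t / (t\<^sup>2 + y\<^sup>2))"
      by (simp add: sums_def)
  qed
qed

section \<open>Asymptotics of the digamma function in the right half-plane\<close>

text \<open>
  Over a step of length one, \<open>Ln\<close> grows like the midpoint value of its derivative; splitting both
  sides against \<open>1 / u\<close> leaves two errors of order \<open>\<bar>u\<bar>\<^sup>-\<^sup>2\<close>.  No branch correction occurs in
  \<open>Ln (u (1 + 1/u))\<close> because both factors lie in the right half-plane.
\<close>

lemma norm_Ln_increment_le:
  fixes u :: complex
  assumes u: "Re u > 0" and n: "norm u \<ge> 2"
  shows "norm (Ln (u + 1) - Ln u - 1 / (u + 1/2)) \<le> 3 / (norm u)\<^sup>2"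
proof -
  have u0: "u \<noteq> 0" using u by auto
  have uh: "u + 1/2 \<noteq> 0" using u by (auto simp: complex_eq_iff)
  have inv: "Re (inverse u) > 0" using u by (auto simp: complex_inverse add_pos_nonneg intro!: divide_pos_pos)
  hence inv1: "Re (1 + inverse u) > 0" by simp
  have "Ln (u * (1 + inverse u)) = Ln u + Ln (1 + inverse u)"
  proof (rule Ln_times_simple)
    have "\<bar>Im (Ln u)\<bar> < pi / 2" "\<bar>Im (Ln (1 + inverse u))\<bar> < pi / 2"
      using u inv1 Re_Ln_pos_lt[of u] Re_Ln_pos_lt[of "1 + inverse u"] by fastforce+
    thus "- pi < Im (Ln u) + Im (Ln (1 + inverse u))" "Im (Ln u) + Im (Ln (1 + inverse u)) \<le> pi"
      by linarith+
    show "1 + inverse u \<noteq> 0" using inv1 by (metis zero_complex.sel(1) less_irrefl)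
  qed (fact u0)
  also have "u * (1 + inverse u) = u + 1" using u0 by (simp add: field_simps)
  finally have "Ln (u + 1) - Ln u - 1 / (u + 1/2) =
     (Ln (1 + inverse u) - inverse u) + (1 / u - 1 / (u + 1/2))"
    by (simp add: inverse_eq_divide)
  also have "norm \<dots> \<le> norm (Ln (1 + inverse u) - inverse u) + norm (1 / u - 1 / (u + 1/2))"
    by (rule norm_triangle_ineq)
  also have "norm (Ln (1 + inverse u) - inverse u) \<le> 2 / (norm u)\<^sup>2"
  proof -
    have n2: "norm (inverse u) \<le> 1/2" using le_imp_inverse_le[OF n] by (simp add: norm_inverse)
    have "norm (Ln (1 + inverse u) - inverse u) \<le> norm (inverse u) ^ 2 / (1 - norm (inverse u))"
      by (rule Ln_approx_linear) (use n2 in auto)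
    also have "\<dots> \<le> norm (inverse u) ^ 2 / (1/2)"
      using n2 by (intro divide_left_mono) auto
    finally show ?thesis by (simp add: norm_inverse power_divide inverse_eq_divide norm_divide)
  qed
  also have "norm (1 / u - 1 / (u + 1/2)) \<le> 1 / (norm u)\<^sup>2"
  proof -
    have "norm u ^ 2 \<le> norm (u + 1/2) ^ 2"
      unfolding cmod_power2 using u by (simp add: power2_eq_square algebra_simps)
    hence le: "norm u \<le> norm (u + 1/2)" by (rule power2_le_imp_le) auto
    have "1 / u - 1 / (u + 1/2) = (1/2) / (u * (u + 1/2))"
      using u0 uh by (simp add: divide_simps)
    also have "norm \<dots> = (1/2) / (norm u * norm (u + 1/2))" by (simp add: norm_divide norm_mult)
    also have "\<dots> \<le> 1 / (norm u * norm u)"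
      using le n by (intro frac_le mult_left_mono mult_pos_pos) auto
    finally show ?thesis by (simp add: power2_eq_square)
  qed
  finally show ?thesis by simp
qed

text \<open>
  The function \<open>\<psi>(1/2 + z) - Ln z\<close> is the sum over \<open>n\<close> of the increments
  \<open>Ln (z + n + 1) - Ln (z + n) - 1 / (z + n + 1/2)\<close>.  They are \<open>O(\<bar>z + n\<bar>\<^sup>-\<^sup>2)\<close>, and \<open>\<bar>z + n\<bar>\<close> is at
  least \<open>(\<bar>z\<bar> + n) / sqrt 2\<close> in the right half-plane, so a telescoping series bounds the sum.
\<close>

lemma norm_Digamma_minus_Ln_le:
  fixes z :: complex
  assumes z: "Re z > 0" and n: "norm z \<ge> 2"
  shows "norm (Digamma (1/2 + z) - Ln z) \<le> 6 / (norm z - 1)"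
proof (rule LIMSEQ_le_const2)
  define S where "S = (\<lambda>m. \<Sum>n<m. Ln (z + of_nat n + 1) - Ln (z + of_nat n) - 1 / (z + of_nat n + 1/2))"
  have h: "1/2 + z \<noteq> 0" using z by (auto simp: complex_eq_iff)
  have S: "S m = Ln (z + of_nat m) - Ln z - (\<Sum>n<m. inverse (1/2 + z + of_nat n))" for m
  proof -
    have "S m = (\<Sum>n<m. Ln (z + of_nat (Suc n)) - Ln (z + of_nat n)) - (\<Sum>n<m. inverse (1/2 + z + of_nat n))"
      by (simp add: S_def sum_subtractf inverse_eq_divide add_ac)
    also have "(\<Sum>n<m. Ln (z + of_nat (Suc n)) - Ln (z + of_nat n)) = Ln (z + of_nat m) - Ln z"
      by (subst sum_lessThan_telescope) simp
    finally show ?thesis .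
  qed
  have "(\<lambda>m. z / of_nat m) \<longlonglongrightarrow> 0"
    using tendsto_mult[OF tendsto_const[of z] lim_inverse_n[where ?'a = complex]] by (simp add: divide_inverse)
  hence "(\<lambda>m. Ln (1 + z / of_nat m)) \<longlonglongrightarrow> Ln (1 + 0)"
    by (intro tendsto_intros) auto
  hence L1: "(\<lambda>m. Ln (1 + z / of_nat m)) \<longlonglongrightarrow> 0" by simp
  have "(\<lambda>m. (of_real (ln (real m)) - (\<Sum>n<m. inverse (1/2 + z + of_nat n))) + Ln (1 + z / of_nat m) - Ln z)
     \<longlonglongrightarrow> Digamma (1/2 + z) + 0 - Ln z"
    by (intro tendsto_diff tendsto_add Digamma_LIMSEQ h L1 tendsto_const)
  moreover have "eventually (\<lambda>m. (of_real (ln (real m)) - (\<Sum>n<m. inverse (1/2 + z + of_nat n))) + Ln (1 + z / of_nat m) - Ln z = S m) sequentially"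
    using eventually_gt_at_top[of 0]
  proof eventually_elim
    case (elim m)
    have ne: "1 + z / of_nat m \<noteq> 0"
    proof -
      have "Re (1 + z / of_nat m) > 0" using z elim by (simp add: add_pos_nonneg)
      thus ?thesis by (metis zero_complex.sel(1) less_irrefl)
    qed
    have "z + of_nat m = of_real (real m) * (1 + z / of_nat m)" using elim by (simp add: field_simps)
    also have "Ln \<dots> = of_real (ln (real m)) + Ln (1 + z / of_nat m)"
      using elim ne by (subst Ln_times_of_real) (auto simp: Ln_of_real)
    finally show ?case by (simp add: S)
  qed
  ultimately have "S \<longlonglongrightarrow> Digamma (1/2 + z) - Ln z"
    by (auto intro: Lim_transform_eventually)
  thus "(\<lambda>m. norm (S m)) \<longlonglongrightarrow> norm (Digamma (1/2 + z) - Ln z)"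
    by (rule tendsto_norm)
  show "\<exists>N. \<forall>m\<ge>N. norm (S m) \<le> 6 / (norm z - 1)"
  proof (intro exI allI impI)
    fix m :: nat
    define r where "r = norm z"
    have r: "r \<ge> 2" using n by (simp add: r_def)
    have "norm (S m) \<le> (\<Sum>n<m. 6 * (1 / (r + real n - 1) - 1 / (r + real (Suc n) - 1)))"
      unfolding S_def
    proof (rule sum_norm_le)
      fix n :: nat
      define u where "u = z + of_nat n"
      have "r\<^sup>2 + (real n)\<^sup>2 \<le> (norm u)\<^sup>2"
        unfolding u_def r_def cmod_power2 using z by (simp add: power2_eq_square algebra_simps)
      moreover have "2 * r * real n \<le> r\<^sup>2 + (real n)\<^sup>2" by (rule sum_squares_bound)
      ultimately have u2: "(r + real n)\<^sup>2 \<le> 2 * (norm u)\<^sup>2" by (simp add: power2_eq_square algebra_simps)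
      have "r\<^sup>2 \<le> (norm u)\<^sup>2" using \<open>r\<^sup>2 + (real n)\<^sup>2 \<le> (norm u)\<^sup>2\<close>
        by (smt (verit) zero_le_power2)
      hence "r \<le> norm u" by (rule power2_le_imp_le) auto
      with r have nu: "norm u \<ge> 2" by simp
      have "norm (Ln (u + 1) - Ln u - 1 / (u + 1/2)) \<le> 3 / (norm u)\<^sup>2"
        by (rule norm_Ln_increment_le) (use z nu in \<open>auto simp: u_def\<close>)
      also have "\<dots> = 6 / (2 * (norm u)\<^sup>2)" by simp
      also have "\<dots> \<le> 6 / (r + real n)\<^sup>2"
        using u2 r nu by (intro divide_left_mono mult_pos_pos) auto
      also have "\<dots> \<le> 6 / ((r + real n - 1) * (r + real n))"
        using r by (intro divide_left_mono mult_pos_pos) (auto simp: power2_eq_square)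
      also have "\<dots> = 6 * (1 / (r + real n - 1) - 1 / (r + real (Suc n) - 1))"
        using r by (simp add: divide_simps)
      finally show "norm (Ln (z + of_nat n + 1) - Ln (z + of_nat n) - 1 / (z + of_nat n + 1/2)) \<le>
         6 * (1 / (r + real n - 1) - 1 / (r + real (Suc n) - 1))"
        by (simp only: u_def)
    qed
    also have "\<dots> = 6 * (1 / (r - 1) - 1 / (r + real m - 1))"
      by (subst sum_distrib_left [symmetric], subst sum_lessThan_telescope') simp
    also have "\<dots> \<le> 6 / (r - 1)"
      using r by simp
    finally show "norm (S m) \<le> 6 / (norm z - 1)" by (simp add: r_def)
  qed
qed

lemma Digamma_minus_Ln_tendsto_0:
  fixes b :: complex
  assumes b: "Re b > 0"
  shows "((\<lambda>y. Digamma (1/2 + b * of_real y) - Ln (b * of_real y)) \<longlongrightarrow> 0) at_top"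
proof (rule Lim_null_comparison)
  have nb: "norm b > 0" using b by auto
  show "((\<lambda>y. 6 / (norm b * y - 1)) \<longlongrightarrow> 0) at_top"
    using nb by real_asymp
  show "\<forall>\<^sub>F y in at_top. norm (Digamma (1/2 + b * of_real y) - Ln (b * of_real y)) \<le> 6 / (norm b * y - 1)"
    using eventually_ge_at_top[of "2 / norm b"]
  proof eventually_elim
    case (elim y)
    have "0 < 2 / norm b" using nb by simp
    hence y: "y > 0" using elim by linarith
    have "norm (Digamma (1/2 + b * of_real y) - Ln (b * of_real y)) \<le> 6 / (norm (b * of_real y) - 1)"
      by (rule norm_Digamma_minus_Ln_le) (use y b elim nb in \<open>auto simp: norm_mult field_simps\<close>)
    thus ?case using y by (simp add: norm_mult)
  qed
qed

section \<open>Integrals involving the exponentially small difference from 1\<close>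

text \<open>
  With \<open>q = e\<^sup>-\<^sup>2\<^sup>a\<^sup>t\<close> one has \<open>1 - tanh (a t) = 2 q / (1 + q)\<close>.  The denominator is bounded away
  from \<open>0\<close>: \<open>\<bar>q\<bar>\<close> is small for large \<open>t\<close>, and on a compact interval \<open>1 + q\<close> is continuous
  without zeros, as \<open>\<bar>q\<bar> = 1\<close> forces \<open>t = 0\<close>, where \<open>q = 1\<close>.
\<close>

lemma norm_one_minus_tanh_le_exp:
  fixes a :: complex
  assumes a: "Re a > 0"
  obtains M where "M > 0" "\<And>t. t \<ge> 0 \<Longrightarrow> cosh (a * of_real t) \<noteq> 0"
    "\<And>t. t \<ge> 0 \<Longrightarrow> norm (1 - tanh (a * of_real t)) \<le> M * exp (- 2 * Re a * t)"
proof -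
  define q where "q = (\<lambda>t. exp (- 2 * a * of_real t))"
  have nq: "norm (q t) = exp (- 2 * Re a * t)" for t by (simp add: q_def)
  have q1: "1 + q t \<noteq> 0" if "t \<ge> 0" for t
  proof
    assume "1 + q t = 0"
    hence q: "q t = -1" by (simp add: add_eq_0_iff)
    hence "exp (- 2 * Re a * t) = 1" using nq[of t] by simp
    hence "t = 0" using a by simp
    thus False using q by (simp add: q_def)
  qed
  have q_cosh: "1 + q t = 2 * exp (- (a * of_real t)) * cosh (a * of_real t)" for t
    by (simp add: q_def cosh_def scaleR_conv_of_real algebra_simps flip: exp_add)
  have cosh0: "cosh (a * of_real t) \<noteq> 0" if "t \<ge> 0" for t
    using q1[OF that] q_cosh[of t] by auto
  have tanh: "1 - tanh (a * of_real t) = 2 * q t / (1 + q t)" if "t \<ge> 0" for t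
  proof -
    have "1 - tanh (a * of_real t) = (cosh (a * of_real t) - sinh (a * of_real t)) / cosh (a * of_real t)"
      using cosh0[OF that] by (simp add: tanh_def diff_divide_distrib)
    also have "cosh (a * of_real t) - sinh (a * of_real t) = exp (- (a * of_real t))"
      by (rule cosh_minus_sinh)
    also have "exp (- (a * of_real t)) / cosh (a * of_real t) = 2 * exp (- (a * of_real t)) ^ 2 / (1 + q t)"
      using cosh0[OF that] by (simp add: q_cosh power2_eq_square)
    also have "exp (- (a * of_real t)) ^ 2 = q t" by (simp add: q_def mult_ac flip: exp_double)
    finally show ?thesis .
  qed
  have "((\<lambda>t. exp (- 2 * Re a * t)) \<longlongrightarrow> 0) at_top" using a by real_asymp
  hence "eventually (\<lambda>t. exp (- 2 * Re a * t) < 1/2) at_top" by (rule order_tendstoD) simp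
  then obtain T where T: "\<And>t. t \<ge> T \<Longrightarrow> exp (- 2 * Re a * t) < 1/2"
    by (auto simp: eventually_at_top_linorder)
  have "compact ((\<lambda>t. 1 / (1 + q t)) ` {0..T})"
    unfolding q_def by (intro compact_continuous_image continuous_intros) (use q1 in \<open>auto simp: q_def\<close>)
  then obtain M0 where M0: "\<And>t. t \<in> {0..T} \<Longrightarrow> norm (1 / (1 + q t)) \<le> M0"
    by (meson bounded_iff compact_imp_bounded imageI)
  define M where "M = max M0 2"
  have M: "norm (1 / (1 + q t)) \<le> M" if t: "t \<ge> 0" for t
  proof (cases "t \<le> T")
    case True
    thus ?thesis using M0[of t] t by (simp add: M_def)
  next
    case False
    have "1 - norm (q t) \<le> norm (1 + q t)"
      using norm_diff_ineq[of 1 "q t"] by simp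
    hence "norm (1 + q t) \<ge> 1/2" using T[of t] False nq[of t] by simp
    hence "norm (1 / (1 + q t)) \<le> 2" by (simp add: norm_divide divide_simps)
    thus ?thesis by (simp add: M_def)
  qed
  show ?thesis
  proof (rule that[of "2 * M"])
    show "2 * M > 0" by (simp add: M_def)
    fix t :: real assume t: "t \<ge> 0"
    have "norm (1 - tanh (a * of_real t)) = 2 * norm (q t) * norm (1 / (1 + q t))"
      unfolding tanh[OF t] by (simp add: norm_mult norm_divide)
    also have "\<dots> \<le> 2 * norm (q t) * M"
      by (intro mult_left_mono M t) auto
    finally show "norm (1 - tanh (a * of_real t)) \<le> 2 * M * exp (- 2 * Re a * t)"
      by (simp add: nq mult_ac)
  qed (use cosh0 in auto)
qed

text \<open>
  Only existence and decay in \<open>y\<close> are established here; the value of \<open>J y\<close> is found afterwards from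
  these two properties.  Both follow from the majorant
  \<open>t / y\<^sup>2\<close> of the kernel, whose growth in \<open>t\<close> costs half of the exponential decay.
\<close>

lemma ex_integral_one_minus_tanh:
  fixes a :: complex
  assumes a: "Re a > 0"
  obtains J where
    "\<And>y. y > 0 \<Longrightarrow> ((\<lambda>t. of_real (t / (t\<^sup>2 + y\<^sup>2)) * (1 - tanh (a * of_real t))) has_integral J y) {0..}"
    "(J \<longlongrightarrow> 0) at_top"
proof -
  obtain M where M: "M > 0" "\<And>t. t \<ge> 0 \<Longrightarrow> cosh (a * of_real t) \<noteq> 0"
    "\<And>t. t \<ge> 0 \<Longrightarrow> norm (1 - tanh (a * of_real t)) \<le> M * exp (- 2 * Re a * t)"
    using norm_one_minus_tanh_le_exp[OF a] by blast
  define f where "f = (\<lambda>y t::real. of_real (t / (t\<^sup>2 + y\<^sup>2)) * (1 - tanh (a * of_real t)))"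
  define h where "h = (\<lambda>y t. M / (Re a * y\<^sup>2) * exp (- Re a * t))"
  have h: "(h y has_integral (M / (Re a * y\<^sup>2) * (1 / Re a))) {0..}" for y
    unfolding h_def using has_integral_mult_right[OF has_integral_exp_minus_to_infinity[OF a, of 0],
      where c = "M / (Re a * y\<^sup>2)"] by simp
  have fh: "norm (f y t) \<le> h y t" if y: "y > 0" and t: "t \<ge> 0" for y t
  proof -
    have "norm (f y t) = t / (t\<^sup>2 + y\<^sup>2) * norm (1 - tanh (a * of_real t))"
      using t by (simp only: f_def norm_mult norm_of_real) simp
    also have "\<dots> \<le> t / y\<^sup>2 * (M * exp (- 2 * Re a * t))"
      using t y by (intro mult_mono M divide_left_mono mult_pos_pos add_nonneg_pos) auto
    also have "\<dots> = M / (Re a * y\<^sup>2) * ((Re a * t) * exp (- 2 * Re a * t))"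
      using a by (simp add: field_simps)
    also have "\<dots> \<le> M / (Re a * y\<^sup>2) * (exp (Re a * t) * exp (- 2 * Re a * t))"
    proof (intro mult_left_mono mult_right_mono)
      show "Re a * t \<le> exp (Re a * t)" using exp_ge_add_one_self[of "Re a * t"] by linarith
    qed (use a M(1) in auto)
    also have "exp (Re a * t) * exp (- 2 * Re a * t) = exp (- Re a * t)"
      by (simp flip: exp_add)
    finally show ?thesis by (simp add: h_def)
  qed
  have fint: "f y integrable_on {0..}" if y: "y > 0" for y
  proof (rule measurable_bounded_by_integrable_imp_integrable)
    have "t\<^sup>2 + y\<^sup>2 \<noteq> 0" for t using y by (metis add_nonneg_eq_0_iff less_irrefl power_eq_0_iff zero_le_power2)
    hence "continuous_on {0..} (f y)"
      unfolding f_def using M(2) by (intro continuous_intros) auto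
    thus "f y \<in> borel_measurable (lebesgue_on {0..})"
      by (rule continuous_imp_measurable_on_sets_lebesgue) auto
    show "h y integrable_on {0..}" using h by blast
  qed (use fh y in auto)
  show ?thesis
  proof (rule that[of "\<lambda>y. integral {0..} (f y)"])
    show "((\<lambda>t. of_real (t / (t\<^sup>2 + y\<^sup>2)) * (1 - tanh (a * of_real t))) has_integral integral {0..} (f y)) {0..}"
      if "y > 0" for y
      using fint[OF that] unfolding f_def by (rule integrable_integral)
    show "((\<lambda>y. integral {0..} (f y)) \<longlongrightarrow> 0) at_top"
    proof (rule Lim_null_comparison)
      show "((\<lambda>y. M / (Re a * y\<^sup>2) * (1 / Re a)) \<longlongrightarrow> 0) at_top"
        using a M(1) by real_asymp
      show "\<forall>\<^sub>F y in at_top. norm (integral {0..} (f y)) \<le> M / (Re a * y\<^sup>2) * (1 / Re a)"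
        using eventually_gt_at_top[of 0]
      proof eventually_elim
        case (elim y)
        have "norm (integral {0..} (f y)) \<le> integral {0..} (h y)"
          by (intro integral_norm_bound_integral fint elim fh) (use h in auto)
        thus ?case using integral_unique[OF h[of y]] by simp
      qed
    qed
  qed
qed

text \<open>
  With \<open>y\<close> fixed, \<open>I y - J y - ln y\<close> equals \<open>I x - J x - ln x\<close> for every \<open>x > 0\<close>, and the latter
  has a known limit as \<open>x \<rightarrow> \<infinity>\<close>.
\<close>

lemma has_integral_one_minus_tanh:
  fixes a :: complex and y :: real
  assumes a: "Re a > 0" and y: "y > 0"
  shows "((\<lambda>t. of_real (t / (t\<^sup>2 + y\<^sup>2)) * (1 - tanh (a * of_real t))) has_integral
            (Digamma (1/2 + a * of_real y / of_real pi) - Ln (a * of_real y / of_real pi))) {0<..}"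
proof -
  obtain J where J:
    "\<And>y. y > 0 \<Longrightarrow> ((\<lambda>t. of_real (t / (t\<^sup>2 + y\<^sup>2)) * (1 - tanh (a * of_real t))) has_integral J y) {0..}"
    "(J \<longlongrightarrow> 0) at_top"
    using ex_integral_one_minus_tanh[OF a] by blast
  define b where "b = a / of_real pi"
  have b: "Re b > 0" "b \<noteq> 0" using a by (auto simp: b_def)
  define I where "I = (\<lambda>y. Digamma (1/2 + b * of_real y) - Digamma (1/2))"
  have I: "((\<lambda>t. tanh (a * of_real t) * of_real (1 / t - t / (t\<^sup>2 + y\<^sup>2))) has_integral I y) {0<..}"
    if "y > 0" for y
    using has_integral_tanh_kernel[OF a that] by (simp add: I_def b_def)
  (* Away from t = 0 the tanh terms combine to tanh(at)/t for x as for y and drop out of the difference. *)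
  have eq: "(I y - J y) - (I x - J x) = of_real (ln y - ln x)" if x: "x > 0" for x
  proof (rule has_integral_unique)
    let ?f = "\<lambda>y t::real. tanh (a * of_real t) * of_real (1 / t - t / (t\<^sup>2 + y\<^sup>2)) -
          of_real (t / (t\<^sup>2 + y\<^sup>2)) * (1 - tanh (a * of_real t))"
    show "((\<lambda>t. ?f y t - ?f x t) has_integral (I y - J y) - (I x - J x)) {0<..}"
      by (intro has_integral_diff I J(1)[THEN has_integral_Ioi_iff_Ici[THEN iffD2]] x y)
    have "((\<lambda>t. complex_of_real (t / (t\<^sup>2 + x\<^sup>2) - t / (t\<^sup>2 + y\<^sup>2))) has_integral of_real (ln y - ln x)) {0<..}"
      unfolding has_integral_Ioi_iff_Ici by (intro has_integral_of_real has_integral_kernel_difference x y)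
    also have "(\<lambda>t. complex_of_real (t / (t\<^sup>2 + x\<^sup>2) - t / (t\<^sup>2 + y\<^sup>2))) = (\<lambda>t. ?f y t - ?f x t)"
      by (rule ext) (unfold of_real_diff, simp only: algebra_simps, simp)
    finally show "((\<lambda>t. ?f y t - ?f x t) has_integral of_real (ln y - ln x)) {0<..}" .
  qed
  (* I x - J x - ln x, rearranged so that each part has a known limit. *)
  have "((\<lambda>x. (Digamma (1/2 + b * of_real x) - Ln (b * of_real x)) - J x + (Ln b - Digamma (1/2)))
           \<longlongrightarrow> 0 - 0 + (Ln b - Digamma (1/2))) at_top"
    by (intro tendsto_add tendsto_diff Digamma_minus_Ln_tendsto_0 b J tendsto_const)
  moreover have "eventually (\<lambda>x. (Digamma (1/2 + b * of_real x) - Ln (b * of_real x)) - J x + (Ln b - Digamma (1/2))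
           = I y - J y - of_real (ln y)) at_top"
    using eventually_gt_at_top[of 0]
  proof eventually_elim
    case (elim x)
    have "Ln (b * of_real x) = Ln b + of_real (ln x)"
      using Ln_times_of_real[OF elim, of b] b elim by (simp add: mult.commute Ln_of_real)
    thus ?case using eq[OF elim] by (simp add: I_def algebra_simps)
  qed
  ultimately have "((\<lambda>x::real. I y - J y - of_real (ln y)) \<longlongrightarrow> Ln b - Digamma (1/2)) at_top"
    by (simp add: tendsto_cong)
  hence "I y - J y - of_real (ln y) = Ln b - Digamma (1/2)"
    by (simp add: tendsto_const_iff)
  moreover have "Ln (b * of_real y) = Ln b + of_real (ln y)"
    using Ln_times_of_real[OF y, of b] b y by (simp add: mult.commute Ln_of_real)
  ultimately have "J y = Digamma (1/2 + b * of_real y) - Ln (b * of_real y)"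
    by (simp add: I_def algebra_simps)
  thus ?thesis
    using J(1)[OF y] unfolding has_integral_Ioi_iff_Ici by (simp add: b_def)
qed

section \<open>The three integrals\<close>

theorem proposition3:
  fixes y :: real and a :: complex
  assumes "Re a > 0"
  shows "((\<lambda>t::real. tanh (a * of_real t) * of_real (1 / t - t / (t\<^sup>2 + y\<^sup>2))) has_integral
            (- Digamma (1/2) + Digamma (1/2 + a * of_real \<bar>y\<bar> / of_real pi))) {0<..} \<and>
         (y \<noteq> 0 \<longrightarrow>
           ((\<lambda>t::real. of_real (t / (t\<^sup>2 + y\<^sup>2)) * (1 - tanh (a * of_real t))) has_integral
              (Digamma (1/2 + a * of_real \<bar>y\<bar> / of_real pi)
                + ln (of_real pi / (a * of_real \<bar>y\<bar>)))) {0<..} \<and>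
           ((\<lambda>t::real. tanh (a * of_real t) / of_real t - of_real (t / (t\<^sup>2 + y\<^sup>2))) has_integral
              (euler_mascheroni + ln (4 * a * of_real \<bar>y\<bar> / of_real pi))) {0<..})"
proof (cases "y = 0")
  case True
  have "(\<lambda>t::real. tanh (a * of_real t) * of_real (1 / t - t / (t\<^sup>2 + y\<^sup>2))) = (\<lambda>t. 0)"
    by (rule ext) (simp add: True power2_eq_square divide_simps)
  thus ?thesis by (simp add: True)
next
  case False
  define z where "z = a * of_real \<bar>y\<bar> / of_real pi"
  have y: "\<bar>y\<bar> > 0" using False by simp
  have z: "Re z > 0" "z \<noteq> 0" using assms y by (auto simp: z_def)
  have int1: "((\<lambda>t::real. tanh (a * of_real t) * of_real (1 / t - t / (t\<^sup>2 + y\<^sup>2))) has_integral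
            (- Digamma (1/2) + Digamma (1/2 + z))) {0<..}"
    using has_integral_tanh_kernel[OF assms y] by (simp add: z_def)
  have int2: "((\<lambda>t::real. of_real (t / (t\<^sup>2 + y\<^sup>2)) * (1 - tanh (a * of_real t))) has_integral
            (Digamma (1/2 + z) - Ln z)) {0<..}"
    using has_integral_one_minus_tanh[OF assms y] by (simp add: z_def)
  have "Ln (inverse z) = - Ln z"
    using z by (intro Ln_inverse) (auto simp: complex_nonpos_Reals_iff)
  moreover have "inverse z = of_real pi / (a * of_real \<bar>y\<bar>)"
    by (simp add: z_def)
  ultimately have Ln_inv: "Ln (of_real pi / (a * of_real \<bar>y\<bar>)) = - Ln z" by simp
  have "Ln (4 * a * of_real \<bar>y\<bar> / of_real pi) = Ln (of_real 4 * z)"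
    by (simp add: z_def mult.assoc)
  also have "\<dots> = of_real (ln 4) + Ln z"
    using Ln_times_of_real[of 4 z] z Ln_of_real[of 4] by simp
  also have "ln (4::real) = 2 * ln 2"
    using ln_realpow[of 2 2] by simp
  finally have Ln4: "Ln (4 * a * of_real \<bar>y\<bar> / of_real pi) = of_real (2 * ln 2) + Ln z" .
  have kernel: "w * of_real (1 / t - k) - of_real k * (1 - w) = w / of_real t - of_real k" for w :: complex and t k :: real
    by (simp add: algebra_simps)
  have "((\<lambda>t::real. tanh (a * of_real t) / of_real t - of_real (t / (t\<^sup>2 + y\<^sup>2))) has_integral
          (- Digamma (1/2) + Digamma (1/2 + z)) - (Digamma (1/2 + z) - Ln z)) {0<..}"
    using has_integral_diff[OF int1 int2] unfolding kernel .
  also have "(- Digamma (1/2) + Digamma (1/2 + z)) - (Digamma (1/2 + z) - Ln z) =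
      euler_mascheroni + Ln (4 * a * of_real \<bar>y\<bar> / of_real pi)"
    unfolding Ln4 by (simp add: Digamma_one_half)
  finally show ?thesis
    using int1 int2 by (simp add: Ln_inv flip: z_def)
qed

end
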